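(* Let $\mathcal{M}=(\mathcal{M}_n)_{n\geq 2}$ be a $2$-rigidity family with $\mathcal{M}\neq\mathcal{R}$. Then $K_{3,3}$ is an $\mathcal{M}$-circuit.
   Context: Graphs are identified with their edge sets (no isolated vertices); a graph on $[n]$ is a subset of $\binom{[n]}{2}$. A graph matroid $\mathcal{M}_n$ (a matroid on ground set $\binom{[n]}{2}$) is symmetric if independence is invariant under relabelling the vertices. A sequence $\mathcal{M}=(\mathcal{M}_n)_{n\geq 2}$ of symmetric graph matroids is a matroidal family if every graph $G\subseteq\binom{\mathbb{N}}{2}$ that is $\mathcal{M}_n$-independent for some $n$ is $\mathcal{M}_n$-independent for all $n\geq v(G)$ (the number of vertices of $G$); one then speaks of $G$ being $\mathcal{M}$-independent/dependent/a circuit. A $2$-rigidity family is a matroidal family in which each $\mathcal{M}_n$ has rank $2n-3$. The family $\mathcal{R}=(\mathcal{R}_n)$ is defined by: $G\subseteq\binom{[n]}{2}$ is $\mathcal{R}_n$-independent iff every set of $m$ vertices, $2\leq m\leq n$, induces at most $2m-3$ edges of $G$. *)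

theory Defs
  imports "HOL-Library.Ramsey" "HOL-Combinatorics.Permutations"
begin

text \<open>A matroid is given by its ground set \<open>E\<close> and its collection \<open>I\<close> of independent sets.\<close>

definition matroid :: "'a set \<Rightarrow> 'a set set \<Rightarrow> bool" where
  "matroid E I \<longleftrightarrow>
     finite E \<and> I \<subseteq> Pow E \<and> {} \<in> I \<and>
     (\<forall>X\<in>I. \<forall>Y\<subseteq>X. Y \<in> I) \<and>
     (\<forall>X\<in>I. \<forall>Y\<in>I. card X < card Y \<longrightarrow> (\<exists>e\<in>Y - X. insert e X \<in> I))"

definition matroid_rank :: "'a set set \<Rightarrow> nat" where
  "matroid_rank I = Max (card ` I)"

text \<open>
  Graphs are sets of two-element vertex sets; the library set \<open>nsets V 2\<close> consists of the edges
  of the complete graph on \<open>V\<close>. The vertices of a graph are the endpoints of its edges.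
\<close>

type_synonym graph = "nat set set"

definition verts :: "graph \<Rightarrow> nat set" where
  "verts G = \<Union> G"

definition relabel :: "(nat \<Rightarrow> nat) \<Rightarrow> graph \<Rightarrow> graph" where
  "relabel f G = (`) f ` G"

definition symmetric_graph_matroid :: "nat \<Rightarrow> graph set \<Rightarrow> bool" where
  "symmetric_graph_matroid n I \<longleftrightarrow>
     matroid (nsets {1..n} 2) I \<and>
     (\<forall>p G. p permutes {1..n} \<longrightarrow> G \<in> I \<longrightarrow> relabel p G \<in> I)"

text \<open>
  A graph on arbitrary labels (not necessarily contained in \<open>{1..n}\<close>) is independent in the
  \<open>n\<close>-th matroid if it has an independent copy on vertices in \<open>{1..n}\<close>. By symmetry the choice of
  the copy is irrelevant.
\<close>

definition indep_in :: "(nat \<Rightarrow> graph set) \<Rightarrow> nat \<Rightarrow> graph \<Rightarrow> bool" where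
  "indep_in M n G \<longleftrightarrow>
     (\<exists>f. inj_on f (verts G) \<and> f ` verts G \<subseteq> {1..n} \<and> relabel f G \<in> M n)"

text \<open>A sequence of matroids is a function on \<open>nat\<close> of which only the values at \<open>n \<ge> 2\<close> matter.\<close>

definition matroidal_family :: "(nat \<Rightarrow> graph set) \<Rightarrow> bool" where
  "matroidal_family M \<longleftrightarrow>
     (\<forall>n\<ge>2. symmetric_graph_matroid n (M n)) \<and>
     (\<forall>G \<subseteq> nsets UNIV 2. (\<exists>n\<ge>2. indep_in M n G) \<longrightarrow>
        (\<forall>n\<ge>2. card (verts G) \<le> n \<longrightarrow> indep_in M n G))"

definition family_indep :: "(nat \<Rightarrow> graph set) \<Rightarrow> graph \<Rightarrow> bool" where
  "family_indep M G \<longleftrightarrow> (\<exists>n\<ge>2. indep_in M n G)"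

definition family_circuit :: "(nat \<Rightarrow> graph set) \<Rightarrow> graph \<Rightarrow> bool" where
  "family_circuit M G \<longleftrightarrow> \<not> family_indep M G \<and> (\<forall>H. H \<subset> G \<longrightarrow> family_indep M H)"

definition two_rigidity_family :: "(nat \<Rightarrow> graph set) \<Rightarrow> bool" where
  "two_rigidity_family M \<longleftrightarrow>
     matroidal_family M \<and> (\<forall>n\<ge>2. matroid_rank (M n) = 2 * n - 3)"

definition rigidity_R :: "nat \<Rightarrow> graph set" where
  "rigidity_R n =
     {G. G \<subseteq> nsets {1..n} 2 \<and>
         (\<forall>X \<subseteq> {1..n}. 2 \<le> card X \<longrightarrow> card {e \<in> G. e \<subseteq> X} \<le> 2 * card X - 3)}"

definition complete_bipartite :: "nat \<Rightarrow> nat \<Rightarrow> graph" where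
  "complete_bipartite a b = {{u, v} | u v. u \<in> {1..a} \<and> v \<in> {a+1..a+b}}"

lemma indep_in_iff:
  assumes sym: "symmetric_graph_matroid n (M n)" and G: "G \<subseteq> nsets {1..n} 2"
  shows "indep_in M n G \<longleftrightarrow> G \<in> M n"
proof
  have V: "verts G \<subseteq> {1..n}" using G by (auto simp: verts_def nsets_def)
  assume "G \<in> M n"
  moreover have "relabel id G = G" by (simp add: relabel_def)
  ultimately show "indep_in M n G"
    unfolding indep_in_def using V by (intro exI[of _ id]) auto
next
  have V: "verts G \<subseteq> {1..n}" using G by (auto simp: verts_def nsets_def)
  assume "indep_in M n G"
  then obtain f where f: "inj_on f (verts G)" "f ` verts G \<subseteq> {1..n}" "relabel f G \<in> M n"
    by (auto simp: indep_in_def)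
  have finV: "finite (verts G)" using V finite_subset by blast
  have "card ({1..n} - f ` verts G) = card ({1..n} - verts G)"
    using V f finV by (simp add: card_Diff_subset card_image)
  then obtain h where h: "bij_betw h ({1..n} - f ` verts G) ({1..n} - verts G)"
    by (meson finite_Diff finite_atLeastAtMost finite_same_card_bij)
  define g where "g = the_inv_into (verts G) f"
  have g: "bij_betw g (f ` verts G) (verts G)"
    unfolding g_def using f(1) by (simp add: bij_betw_imageI bij_betw_the_inv_into)
  define p where
    "p = (\<lambda>x. if x \<in> {1..n} then (if x \<in> f ` verts G then g x else h x) else x)"
  have 1: "bij_betw p (f ` verts G) (verts G)"
    using g f(2) by (subst bij_betw_cong[of _ _ g]) (auto simp: p_def)
  have 2: "bij_betw p ({1..n} - f ` verts G) ({1..n} - verts G)"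
    using h by (subst bij_betw_cong[of _ _ h]) (auto simp: p_def)
  have "bij_betw p (f ` verts G \<union> ({1..n} - f ` verts G)) (verts G \<union> ({1..n} - verts G))"
    using 1 2 by (rule bij_betw_combine) auto
  moreover have "f ` verts G \<union> ({1..n} - f ` verts G) = {1..n}" using f(2) by blast
  moreover have "verts G \<union> ({1..n} - verts G) = {1..n}" using V by blast
  ultimately have "bij_betw p {1..n} {1..n}" by simp
  then have "p permutes {1..n}" by (intro bij_imp_permutes) (auto simp: p_def)
  then have "relabel p (relabel f G) \<in> M n"
    using sym f(3) by (auto simp: symmetric_graph_matroid_def)
  moreover have pf: "p (f x) = x" if "x \<in> verts G" for x
    using that f by (auto simp: p_def g_def the_inv_into_f_f)
  have "p ` f ` e = e" if "e \<in> G" for e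
    using that pf by (force simp: verts_def image_image)
  then have "relabel p (relabel f G) = G" by (simp add: relabel_def image_image)
  ultimately show "G \<in> M n" by simp
qed

end

theory Submission
  imports Defs
begin

text \<open>
  \<open>K\<^sub>4\<close> is a circuit of \<open>\<M>\<close>, so adding a vertex of degree 2 preserves independence; hence every proper
  subgraph of \<open>K\<^sub>3\<^sub>,\<^sub>3\<close> is independent. If \<open>K\<^sub>3\<^sub>,\<^sub>3\<close> itself is independent, then, having 9 edges on 6 vertices,
  it spans \<open>K\<^sub>6\<close>, and this forces 1-extensions (subdividing an edge and joining the new vertex
  to a third vertex) to preserve independence as well. By Henneberg's construction every
  \<open>\<R>\<close>-independent graph is then \<open>\<M>\<close>-independent, so \<open>\<M> = \<R>\<close>.
\<close>

subsection \<open>Rank in a finitary matroid\<close>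

text \<open>Two coincidences in the rank formula drive the proof. On four vertices it gives
  \<open>2 * 4 - 3 = 5\<close>, one less than the number of edges of the complete graph; since all
  edges of that graph are alike, symmetry alone makes it a circuit. On six vertices it gives 9, the
  number of edges of \<open>complete_bipartite 3 3\<close>; so the latter, once independent, is a
  basis and spans even the pairs inside one of its sides. This is how an edge deleted in a
  1-extension is recovered. The obstacle is room: the argument attaches three new vertices to a
  graph that may already use all of \<open>{1..n}\<close>. Hence the matroids are merged into a
  single one on the finite graphs over \<open>nat\<close>, invariant under every injective renaming;
  the compatibility of the \<open>M n\<close> makes this possible. The inclusion of each
  \<open>M n\<close> in \<open>rigidity_R n\<close> comes from the rank formula alone.\<close>

locale independence_system =
  fixes J :: "'a set set"
  assumes empty_indep: "{} \<in> J"
    and indep_finite: "X \<in> J \<Longrightarrow> finite X"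
    and indep_subset: "X \<in> J \<Longrightarrow> Y \<subseteq> X \<Longrightarrow> Y \<in> J"
    and augment: "X \<in> J \<Longrightarrow> Y \<in> J \<Longrightarrow> card X < card Y \<Longrightarrow> \<exists>e\<in>Y - X. insert e X \<in> J"
begin

text \<open>The ground set may be infinite, and \<open>Max\<close> is meaningful only over a finite
  set; hence the finiteness hypotheses in what follows.\<close>

definition rank :: "'a set \<Rightarrow> nat" where
  "rank A = Max (card ` {B. B \<subseteq> A \<and> B \<in> J})"

lemma card_le_rank:
  assumes "finite A" "B \<subseteq> A" "B \<in> J"
  shows "card B \<le> rank A"
  using assms unfolding rank_def by (intro Max_ge) auto

lemma rank_witness:
  assumes "finite A"
  obtains B where "B \<subseteq> A" "B \<in> J" "card B = rank A"
proof -
  have "rank A \<in> card ` {B. B \<subseteq> A \<and> B \<in> J}"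
    unfolding rank_def using assms empty_indep by (intro Max_in) auto
  then show thesis using that by auto
qed

lemma rank_le_card: "finite A \<Longrightarrow> rank A \<le> card A"
  by (metis rank_witness card_mono)

lemma rank_mono: "finite B \<Longrightarrow> A \<subseteq> B \<Longrightarrow> rank A \<le> rank B"
  by (metis rank_witness card_le_rank finite_subset subset_trans)

lemma indep_rank: "A \<in> J \<Longrightarrow> rank A = card A"
  by (simp add: card_le_rank indep_finite le_antisym rank_le_card)

lemma indepI:
  assumes "finite A" "card A \<le> rank A"
  shows "A \<in> J"
  using assms by (metis rank_witness card_seteq)

lemma extend_to_basis:
  assumes "finite A" "I \<in> J" "I \<subseteq> A"
  obtains B where "I \<subseteq> B" "B \<subseteq> A" "B \<in> J" "card B = rank A"
proof -
  have "\<exists>B. I \<subseteq> B \<and> B \<subseteq> A \<and> B \<in> J \<and> card B = rank A"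
    using assms(2,3)
  proof (induction "rank A - card I" arbitrary: I rule: less_induct)
    case less
    show ?case
    proof (cases "card I = rank A")
      case True
      then show ?thesis using less.prems by blast
    next
      case False
      then have lt: "card I < rank A" using card_le_rank[OF assms(1) less.prems(2,1)] by simp
      obtain C where C: "C \<subseteq> A" "C \<in> J" "card C = rank A" using rank_witness[OF assms(1)] by blast
      obtain e where e: "e \<in> C - I" "insert e I \<in> J" using augment less.prems C lt by metis
      have "card (insert e I) = Suc (card I)" using e indep_finite less.prems by auto
      then have "rank A - card (insert e I) < rank A - card I" using lt by simp
      moreover have "insert e I \<subseteq> A" using e C less.prems by blast
      ultimately show ?thesis using less.hyps[OF _ e(2)] by blast
    qed
  qed
  then show thesis using that by blast
qed

text \<open>A basis \<open>I\<close> of the intersection extends to a basis \<open>C\<close> of the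
  union. Counting \<open>C\<close> inside \<open>A\<close> and inside \<open>B\<close> counts every
  element of \<open>C\<close> once and those of \<open>I\<close> twice.\<close>

lemma rank_submodular:
  assumes "finite A" "finite B"
  shows "rank (A \<union> B) + rank (A \<inter> B) \<le> rank A + rank B"
proof -
  obtain I where I: "I \<subseteq> A \<inter> B" "I \<in> J" "card I = rank (A \<inter> B)"
    using rank_witness[of "A \<inter> B"] assms(1) by (metis finite_Int)
  obtain C where C: "I \<subseteq> C" "C \<subseteq> A \<union> B" "C \<in> J" "card C = rank (A \<union> B)"
    by (rule extend_to_basis[of "A \<union> B" I]) (use I assms in auto)
  have "card (C \<inter> A) + card (C \<inter> B) = card ((C \<inter> A) \<union> (C \<inter> B)) + card ((C \<inter> A) \<inter> (C \<inter> B))"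
    by (rule card_Un_Int) (use indep_finite[OF C(3)] in auto)
  moreover have "(C \<inter> A) \<union> (C \<inter> B) = C" using C by blast
  moreover have "card I \<le> card ((C \<inter> A) \<inter> (C \<inter> B))"
    using I C(1) indep_finite[OF C(3)] by (intro card_mono) auto
  moreover have "card (C \<inter> A) \<le> rank A" "card (C \<inter> B) \<le> rank B"
    by (rule card_le_rank; use assms indep_subset[OF C(3)] in simp)+
  ultimately show ?thesis using I C by simp
qed

text \<open>Spares computing the intersection: any common subset serves as a lower bound for
  it.\<close>

lemma rank_submodular':
  assumes "finite A" "finite B" "C \<subseteq> A" "C \<subseteq> B"
  shows "rank (A \<union> B) + rank C \<le> rank A + rank B"
proof -
  have "rank C \<le> rank (A \<inter> B)" using assms by (intro rank_mono) auto
  then show ?thesis using rank_submodular[OF assms(1,2)] by linarith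
qed

text \<open>Monotonicity of the closure operator: the equation
  \<open>rank (insert e A) = rank A\<close> stands for membership of \<open>e\<close> in the closure
  of \<open>A\<close>.\<close>

lemma spanned_mono:
  assumes "finite B" "A \<subseteq> B" "rank (insert e A) = rank A"
  shows "rank (insert e B) = rank B"
proof -
  have "finite A" using assms finite_subset by blast
  then have "rank (insert e A \<union> B) + rank A \<le> rank (insert e A) + rank B"
    using assms by (intro rank_submodular') auto
  moreover have "insert e A \<union> B = insert e B" using assms by blast
  moreover have "rank B \<le> rank (insert e B)" using assms by (intro rank_mono) auto
  ultimately show ?thesis using assms by simp
qed

lemma spanned_union:
  assumes "finite A" "finite T" "\<And>e. e \<in> T \<Longrightarrow> rank (insert e A) = rank A"
  shows "rank (A \<union> T) = rank A"
  using assms(2,3)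
proof (induction T)
  case (insert e T)
  have "rank (insert e (A \<union> T)) = rank (A \<union> T)"
    by (rule spanned_mono[of "A \<union> T" A]) (use assms(1) insert in auto)
  then show ?case using insert by simp
qed simp

end

subsection \<open>Extension of independent graphs by a vertex\<close>

lemma relabel_subset_nsets:
  assumes "inj_on f V" "G \<subseteq> nsets V 2"
  shows "relabel f G \<subseteq> nsets (f ` V) 2"
proof
  fix e
  assume "e \<in> relabel f G"
  then obtain d where d: "d \<in> nsets V 2" "e = f ` d" using assms(2) by (auto simp: relabel_def)
  then have sub: "d \<subseteq> V" "finite d" "card d = 2" by (auto simp: nsets_def)
  then have "card (f ` d) = 2" using card_image[OF inj_on_subset[OF assms(1)]] by simp
  then show "e \<in> nsets (f ` V) 2" using d sub by (simp add: nsets_def image_mono)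
qed

lemma card_relabel:
  assumes "inj_on f V" "G \<subseteq> nsets V 2"
  shows "card (relabel f G) = card G"
proof -
  have "inj_on ((`) f) G"
    using assms(2) by (intro inj_on_subset[OF inj_on_image_Pow[OF assms(1)]]) (auto simp: nsets_def)
  then show ?thesis by (simp add: relabel_def card_image)
qed

text \<open>The last two assumptions together fix the rank of the complete graph on
  \<open>V\<close>. They concern arbitrary finite \<open>V\<close> rather than
  \<open>{1..n}\<close>, so that fresh vertices can always be chosen.\<close>

locale rigidity_matroid = independence_system J for J :: "graph set" +
  assumes relabel_indep: "G \<in> J \<Longrightarrow> inj_on f (verts G) \<Longrightarrow> relabel f G \<in> J"
    and indep_card_le:
      "G \<in> J \<Longrightarrow> G \<subseteq> nsets V 2 \<Longrightarrow> finite V \<Longrightarrow> 2 \<le> card V \<Longrightarrow> card G \<le> 2 * card V - 3"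
    and indep_exists:
      "finite V \<Longrightarrow> 2 \<le> card V \<Longrightarrow> \<exists>G\<in>J. G \<subseteq> nsets V 2 \<and> card G = 2 * card V - 3"
begin

section \<open>Complete graphs and new vertices of degree 2\<close>

lemma rank_complete:
  assumes "finite V" "2 \<le> card V"
  shows "rank (nsets V 2) = 2 * card V - 3"
proof (rule antisym)
  have fin: "finite (nsets V 2)" using assms by (simp add: finite_imp_finite_nsets)
  obtain B where "B \<subseteq> nsets V 2" "B \<in> J" "card B = rank (nsets V 2)"
    by (rule rank_witness[OF fin])
  then show "rank (nsets V 2) \<le> 2 * card V - 3"
    using indep_card_le[of B V] assms by simp
  show "2 * card V - 3 \<le> rank (nsets V 2)"
    by (metis indep_exists assms card_le_rank fin)
qed

text \<open>Some basis has 5 of the 6 edges. A permutation of \<open>V\<close> that takes the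
  missing edge \<open>d\<close> to \<open>e\<close> takes this basis to the graph in
  question.\<close>

lemma K4_minus_edge_indep:
  assumes V: "card V = 4" and e: "e \<in> nsets V 2"
  shows "nsets V 2 - {e} \<in> J"
proof -
  have finV: "finite V" using V card.infinite by fastforce
  obtain G where G: "G \<in> J" "G \<subseteq> nsets V 2" "card G = 5"
    using indep_exists[OF finV] V by auto
  have "card (nsets V 2) = 6" using V by (simp add: card_nsets choose_two)
  then have "card (nsets V 2 - G) = 1"
    using G indep_finite by (simp add: card_Diff_subset)
  then obtain d where d: "nsets V 2 - G = {d}" by (auto simp: card_1_singleton_iff)
  then have dV: "d \<in> nsets V 2" by blast
  have sub: "d \<subseteq> V" "e \<subseteq> V" and fin: "finite d" "finite e" and cd: "card d = 2" "card e = 2"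
    using dV e by (auto simp: nsets_def)
  obtain g where g: "bij_betw g d e" using fin cd finite_same_card_bij by metis
  have "card (V - d) = card (V - e)" using sub fin cd by (simp add: card_Diff_subset)
  then obtain h where h: "bij_betw h (V - d) (V - e)"
    using finV finite_same_card_bij by (metis finite_Diff)
  define f where "f = (\<lambda>x. if x \<in> d then g x else h x)"
  have "bij_betw f (d \<union> (V - d)) (e \<union> (V - e))"
  proof (rule bij_betw_combine)
    show "bij_betw f d e" using g by (subst bij_betw_cong[of _ _ g]) (auto simp: f_def)
    show "bij_betw f (V - d) (V - e)" using h by (subst bij_betw_cong[of _ _ h]) (auto simp: f_def)
  qed auto
  then have f: "bij_betw f V V" using sub by (simp add: Un_absorb1)
  have fd: "f ` d = e" using g by (auto simp: f_def bij_betw_def)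
  have inj: "inj_on f V" using f by (simp add: bij_betw_def)
  have "verts G \<subseteq> V" using G by (auto simp: verts_def nsets_def)
  then have "relabel f G \<in> J" using relabel_indep G inj inj_on_subset by metis
  moreover have "relabel f G = nsets V 2 - {e}"
  proof (rule card_subset_eq)
    have "e \<notin> relabel f G"
    proof
      assume "e \<in> relabel f G"
      then obtain x where x: "x \<in> G" "f ` x = f ` d" using fd by (auto simp: relabel_def)
      then have "x \<subseteq> V" using G by (auto simp: nsets_def)
      then have "x = d" using x(2) sub inj by (simp add: inj_on_image_eq_iff)
      then show False using x(1) d by blast
    qed
    moreover have "f ` V = V" using f by (simp add: bij_betw_def)
    ultimately show "relabel f G \<subseteq> nsets V 2 - {e}"
      using relabel_subset_nsets[OF inj G(2)] by auto
    have "card (relabel f G) = 5" using card_relabel[OF inj G(2)] G(3) by simp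
    then show "card (relabel f G) = card (nsets V 2 - {e})"
      using \<open>card (nsets V 2) = 6\<close> e by simp
  qed (use finV in \<open>simp add: finite_imp_finite_nsets\<close>)
  ultimately show ?thesis by simp
qed

text \<open>Two edges at \<open>v\<close> already span all others: an edge \<open>{v, c}\<close>
  completes a circuit on \<open>{v, a, b, c}\<close> whose other five edges are present. The value
  is \<open>2 * (card V + 1) - 3\<close>.\<close>

lemma rank_add_vertex:
  assumes V: "finite V" "a \<in> V" "b \<in> V" "a \<noteq> b" "v \<notin> V"
  shows "rank (insert {v, a} (insert {v, b} (nsets V 2))) = 2 * card V - 1"
proof -
  let ?S = "insert {v, a} (insert {v, b} (nsets V 2))"
  have fin: "finite ?S" "finite (nsets (insert v V) 2)"
    using V by (simp_all add: finite_imp_finite_nsets)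
  have "card {a, b} \<le> card V" using V by (intro card_mono) auto
  then have c2: "2 \<le> card V" using V by simp
  have "rank (insert e ?S) = rank ?S" if e: "e \<in> nsets (insert v V) 2" for e
  proof (cases "e \<in> ?S")
    case True
    then show ?thesis by (simp add: insert_absorb)
  next
    case False
    obtain p q where pq: "e = {p, q}" "p \<noteq> q" "p \<in> insert v V" "q \<in> insert v V"
      using e by (auto simp: nsets_def card_2_iff)
    obtain c where c: "c \<in> V" "e = {v, c}"
      using pq False by (auto simp: insert_commute)
    then have abc: "c \<noteq> a" "c \<noteq> b" using False by auto
    let ?K = "nsets {v, a, b, c} 2 - {e}"
    have vabc: "v \<noteq> a" "v \<noteq> b" "v \<noteq> c" using V c by auto
    have c4: "card {v, a, b, c} = 4" using V abc vabc by auto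
    have eK: "e \<in> nsets {v, a, b, c} 2" using c vabc by (simp add: doubleton_in_nsets_2)
    have K: "?K \<in> J" using K4_minus_edge_indep[OF c4 eK] .
    have "rank ?K = 5"
      using indep_rank[OF K] eK c4 by (simp add: card_nsets choose_two)
    moreover have "rank (insert e ?K) = 5"
      using rank_complete[of "{v, a, b, c}"] eK c4 by (simp add: insert_absorb)
    moreover have "?K \<subseteq> ?S"
    proof
      fix d
      assume d: "d \<in> ?K"
      then obtain p q where "d = {p, q}" "p \<noteq> q" "p \<in> {v, a, b, c}" "q \<in> {v, a, b, c}"
        by (elim DiffE nsets2_E) auto
      moreover have "d \<noteq> {v, c}" using d c by simp
      ultimately show "d \<in> ?S" using c V by (auto simp add: doubleton_eq_iff)
    qed
    ultimately show ?thesis using spanned_mono[OF fin(1)] by metis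
  qed
  then have "rank (?S \<union> nsets (insert v V) 2) = rank ?S"
    by (intro spanned_union) (use fin in auto)
  moreover have "?S \<union> nsets (insert v V) 2 = nsets (insert v V) 2"
  proof -
    have "nsets V 2 \<subseteq> nsets (insert v V) 2" by (intro nsets_mono) auto
    moreover have "{v, a} \<in> nsets (insert v V) 2" "{v, b} \<in> nsets (insert v V) 2"
      using V by auto
    ultimately show ?thesis by blast
  qed
  moreover have "rank (nsets (insert v V) 2) = 2 * card V - 1"
    using V c2 by (subst rank_complete) auto
  ultimately show ?thesis by simp
qed

text \<open>Adding the two edges to the complete graph on \<open>V\<close> raises its rank by
  exactly 2; by submodularity they raise the rank of the smaller graph \<open>G\<close> by at least
  as much.\<close>

lemma zero_extension:
  assumes G: "G \<in> J" "G \<subseteq> nsets V 2"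
    and V: "finite V" "a \<in> V" "b \<in> V" "a \<noteq> b" "v \<notin> V"
  shows "insert {v, a} (insert {v, b} G) \<in> J"
proof (rule indepI)
  let ?G = "insert {v, a} (insert {v, b} G)"
  show fin: "finite ?G" using G indep_finite by simp
  have "card {a, b} \<le> card V" using V by (intro card_mono) auto
  then have c2: "2 \<le> card V" using V by simp
  have "rank (?G \<union> nsets V 2) + rank G \<le> rank ?G + rank (nsets V 2)"
    using fin V G by (intro rank_submodular') (auto simp: finite_imp_finite_nsets)
  moreover have "?G \<union> nsets V 2 = insert {v, a} (insert {v, b} (nsets V 2))"
    using G by auto
  ultimately have "2 * card V - 1 + card G \<le> rank ?G + (2 * card V - 3)"
    using rank_add_vertex[OF V] rank_complete[OF V(1) c2] indep_rank[OF G(1)] by simp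
  moreover have "card ?G \<le> card G + 2"
    using G indep_finite by (simp add: card_insert_if)
  ultimately show "card ?G \<le> rank ?G" using c2 by simp
qed

text \<open>The sides are \<open>{a, b, u}\<close> and \<open>{c, d, w}\<close>, and the missing
  edge is \<open>{u, w}\<close>. Starting from \<open>a\<close> and \<open>b\<close> without edges,
  each of \<open>c\<close>, \<open>d\<close>, \<open>u\<close>, \<open>w\<close> in this order meets
  just two earlier vertices.\<close>

lemma K33_minus_edge_indep:
  assumes "distinct [a, b, u, c, d, w]"
  shows "{{a, c}, {b, c}, {a, d}, {b, d}, {u, c}, {u, d}, {w, a}, {w, b}} \<in> J"
proof -
  have 1: "{{c, a}, {c, b}} \<in> J"
    using zero_extension[of "{}" "{a, b}" a b c] empty_indep assms by auto
  have 2: "insert {d, a} (insert {d, b} {{c, a}, {c, b}}) \<in> J"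
    using zero_extension[OF 1, of "{a, b, c}" a b d] assms by auto
  have 3: "insert {u, c} (insert {u, d} {{d, a}, {d, b}, {c, a}, {c, b}}) \<in> J"
    using zero_extension[OF 2, of "{a, b, c, d}" c d u] assms by auto
  have 4: "insert {w, a} (insert {w, b} {{u, c}, {u, d}, {d, a}, {d, b}, {c, a}, {c, b}}) \<in> J"
    using zero_extension[OF 3, of "{a, b, c, d, u}" a b w] assms by auto
  show ?thesis by (rule indep_subset[OF 4]) (auto simp: insert_commute)
qed

section \<open>Copies of the complete bipartite graph and new vertices of degree 3\<close>

lemma K33_indep_relabel:
  assumes K: "complete_bipartite 3 3 \<in> J" and d: "distinct [x, y, z, p, q, r]"
  shows "{{p, x}, {p, y}, {p, z}, {q, x}, {q, y}, {q, z}, {r, x}, {r, y}, {r, z}} \<in> J"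
    (is "?K \<in> J")
proof -
  define f where "f = (\<lambda>i::nat. [x, y, z, p, q, r] ! (i - 1))"
  have "{1..6} = {1, 2, 3, 4, 5, 6::nat}" by auto
  then have "inj_on f {1..6}" using d by (auto simp: f_def)
  moreover have K33: "complete_bipartite 3 3 =
      {{1, 4}, {1, 5}, {1, 6}, {2, 4}, {2, 5}, {2, 6}, {3, 4}, {3, 5}, {3, 6}}"
  proof -
    have "{1..3} = {1, 2, 3::nat}" "{3 + 1..3 + 3} = {4, 5, 6::nat}" by auto
    moreover have "complete_bipartite 3 3 = (\<Union>u\<in>{1..3}. \<Union>v\<in>{3 + 1..3 + 3}. {{u, v}})"
      unfolding complete_bipartite_def by blast
    ultimately show ?thesis by (simp only: UN_insert UN_empty Un_empty_right Un_insert_left Un_empty_left)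
  qed
  moreover have "verts (complete_bipartite 3 3) \<subseteq> {1..6}"
    unfolding K33 verts_def by auto
  ultimately have "relabel f (complete_bipartite 3 3) \<in> J"
    using relabel_indep K inj_on_subset by metis
  moreover have "relabel f (complete_bipartite 3 3) =
      {{x, p}, {x, q}, {x, r}, {y, p}, {y, q}, {y, r}, {z, p}, {z, q}, {z, r}}"
    unfolding K33 relabel_def by (simp add: f_def)
  moreover have "\<dots> = ?K" by (simp add: insert_commute)
  ultimately show ?thesis by simp
qed


text \<open>
  If the extension were dependent, so would be each of its copies at fresh vertices \<open>v\<close>, and by
  submodularity three copies would add at most 6 to the rank of \<open>G - {{x, y}}\<close>. But the three
  copies form a \<open>K\<^sub>3\<^sub>,\<^sub>3\<close> that spans \<open>{x, y}\<close>, while \<open>G\<close> together with two edges for each copy has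
  rank larger by 7.
\<close>
lemma one_extension:
  assumes K: "complete_bipartite 3 3 \<in> J"
    and G: "G \<in> J" "G \<subseteq> nsets V 2" "{x, y} \<in> G"
    and V: "finite V" "x \<in> V" "y \<in> V" "z \<in> V" "distinct [x, y, z]" "v \<notin> V"
  shows "{{v, x}, {v, y}, {v, z}} \<union> (G - {{x, y}}) \<in> J"
proof (rule ccontr)
  assume dep: "{{v, x}, {v, y}, {v, z}} \<union> (G - {{x, y}}) \<notin> J"
  define H where "H = G - {{x, y}}"
  define Q where "Q = (\<lambda>u. {{u, x}, {u, y}, {u, z}})"
  have HJ: "H \<in> J" unfolding H_def using G(1) indep_subset by blast
  have GH: "G = insert {x, y} H" and xyH: "{x, y} \<notin> H" using G(3) by (auto simp: H_def)
  have finH: "finite H" using HJ indep_finite by blast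
  have vH: "verts H \<subseteq> V" using G(2) by (auto simp: H_def verts_def nsets_def)
  have fins: "finite (H \<union> Q u)" for u using finH by (simp add: Q_def)
  have Qu: "rank (H \<union> Q u) \<le> card H + 2" if u: "u \<notin> V" for u
  proof (rule ccontr)
    assume "\<not> rank (H \<union> Q u) \<le> card H + 2"
    moreover have "card (H \<union> Q u) \<le> card H + card (Q u)" by (rule card_Un_le)
    moreover have "card (Q u) \<le> 3" by (simp add: Q_def card_insert_if)
    ultimately have ind: "H \<union> Q u \<in> J" by (intro indepI[OF fins]) simp
    \<comment> \<open>\<open>f\<close> fixes \<open>V\<close> pointwise and moves the new vertex
      \<open>u\<close> to \<open>v\<close>, so it turns the copy at \<open>u\<close> into the
      extension assumed dependent.\<close>
    define f where "f = (\<lambda>i. if i = u then v else i)"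
    have "verts (H \<union> Q u) \<subseteq> insert u V"
      using vH V by (auto simp: verts_def Q_def)
    moreover have "inj_on f (insert u V)" using V u by (auto simp: f_def inj_on_def)
    ultimately have "relabel f (H \<union> Q u) \<in> J"
      using relabel_indep[OF ind] inj_on_subset by blast
    moreover have "relabel f H = H"
    proof -
      have "f ` e = e" if "e \<in> H" for e
      proof -
        have "e \<subseteq> V" using vH that by (auto simp: verts_def)
        then have "\<And>i. i \<in> e \<Longrightarrow> f i = i" using u by (auto simp: f_def)
        then show ?thesis by simp
      qed
      then show ?thesis by (simp add: relabel_def)
    qed
    moreover have "relabel f (Q u) = Q v"
      using V u by (auto simp: relabel_def Q_def f_def)
    ultimately have "H \<union> Q v \<in> J" by (simp add: relabel_def image_Un)
    then show False using dep by (simp add: H_def Q_def Un_commute)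
  qed
  obtain p where p: "p \<notin> V" using V(1) ex_new_if_finite infinite_UNIV_nat by blast
  obtain q where q: "q \<notin> insert p V"
    using V(1) ex_new_if_finite[of "insert p V"] infinite_UNIV_nat by auto
  obtain r where r: "r \<notin> insert q (insert p V)"
    using V(1) ex_new_if_finite[of "insert q (insert p V)"] infinite_UNIV_nat by auto
  have d: "distinct [x, y, z, p, q, r]" using V p q r by auto
  \<comment> \<open>\<open>d\<close> gives each inequality in one orientation only; the reversed
    list supplies the other one to the simplifier.\<close>
  then have d': "distinct [r, q, p, z, y, x]" by auto
  define K where "K = Q p \<union> Q q \<union> Q r"
  \<comment> \<open>The three copies share \<open>H\<close>, and each contributes at most 2 beyond
    \<open>card H\<close>; gluing along \<open>H\<close> therefore yields at most
    \<open>card H + 6\<close>.\<close>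
  have "rank ((H \<union> Q p) \<union> (H \<union> Q q)) + rank H \<le> rank (H \<union> Q p) + rank (H \<union> Q q)"
    by (intro rank_submodular' fins) auto
  moreover have "rank (((H \<union> Q p) \<union> (H \<union> Q q)) \<union> (H \<union> Q r)) + rank H
      \<le> rank ((H \<union> Q p) \<union> (H \<union> Q q)) + rank (H \<union> Q r)"
    by (intro rank_submodular' fins finite_UnI) auto
  moreover have "((H \<union> Q p) \<union> (H \<union> Q q)) \<union> (H \<union> Q r) = H \<union> K"
    by (auto simp: K_def)
  ultimately have upper: "rank (H \<union> K) \<le> card H + 6"
    using Qu[of p] Qu[of q] Qu[of r] p q r indep_rank[OF HJ] by simp
  have finK: "finite K" by (simp add: K_def Q_def)
  have "rank (insert {x, y} (H \<union> K)) = rank (H \<union> K)"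
  proof (rule spanned_mono[of "H \<union> K" K])
    have KJ: "K \<in> J"
      using K33_indep_relabel[OF K d] by (simp add: K_def Q_def insert_commute)
    have cardK: "card K = 9"
      using d d' by (simp add: K_def Q_def doubleton_eq_iff)
    have c6: "card {x, y, z, p, q, r} = 6" using d by simp
    \<comment> \<open>\<open>K\<close> has \<open>9 = 2 * 6 - 3\<close> edges, as many as the rank
      on its six vertices, so no further edge between them can raise its rank.\<close>
    have "insert {x, y} K \<subseteq> nsets {x, y, z, p, q, r} 2"
      using d d' by (simp add: K_def Q_def)
    then have "rank (insert {x, y} K) \<le> rank (nsets {x, y, z, p, q, r} 2)"
      by (intro rank_mono) (simp_all add: finite_imp_finite_nsets)
    also have "\<dots> = 9" using rank_complete[of "{x, y, z, p, q, r}"] c6 by simp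
    finally have "rank (insert {x, y} K) \<le> rank K" using cardK indep_rank[OF KJ] by simp
    moreover have "rank K \<le> rank (insert {x, y} K)" using finK by (intro rank_mono) auto
    ultimately show "rank (insert {x, y} K) = rank K" by simp
  qed (use finH finK in auto)
  \<comment> \<open>The 7 is one for \<open>{x, y}\<close> itself and two for each new vertex,
    joined to \<open>x\<close> and \<open>y\<close> only.\<close>
  moreover have "card H + 7 \<le> rank (insert {x, y} (H \<union> K))"
  proof -
    have sub: "insert {u, x} (insert {u, y} F) \<subseteq> nsets (insert u W) 2"
      if "F \<subseteq> nsets W 2" "u \<notin> W" "x \<in> W" "y \<in> W" for F u W
      using that nsets_mono[of W "insert u W" 2] by auto
    have new: "card (insert {u, x} (insert {u, y} F)) = card F + 2"
      if "F \<subseteq> nsets W 2" "u \<notin> W" "finite F" for F u W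
    proof -
      have "{u, x} \<notin> F" "{u, y} \<notin> F" using that by (auto simp: nsets_def)
      then show ?thesis using that(3) V(5) by (simp add: doubleton_eq_iff)
    qed
    define F1 where "F1 = insert {p, x} (insert {p, y} G)"
    define F2 where "F2 = insert {q, x} (insert {q, y} F1)"
    define F3 where "F3 = insert {r, x} (insert {r, y} F2)"
    have xy: "x \<noteq> y" using V by simp
    have s1: "F1 \<subseteq> nsets (insert p V) 2" unfolding F1_def using sub G p V by blast
    have s2: "F2 \<subseteq> nsets (insert q (insert p V)) 2" unfolding F2_def using sub s1 q V by blast
    have J1: "F1 \<in> J" unfolding F1_def by (rule zero_extension[OF G(1,2)]) (use V p xy in auto)
    have J2: "F2 \<in> J" unfolding F2_def by (rule zero_extension[OF J1 s1]) (use V q xy in auto)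
    have J3: "F3 \<in> J" unfolding F3_def by (rule zero_extension[OF J2 s2]) (use V r xy in auto)
    have "card F3 = card F2 + 2" unfolding F3_def by (rule new[OF s2 r indep_finite[OF J2]])
    also have "card F2 = card F1 + 2" unfolding F2_def by (rule new[OF s1 q indep_finite[OF J1]])
    also have "card F1 = card G + 2" unfolding F1_def by (rule new[OF G(2) p indep_finite[OF G(1)]])
    also have "card G = card H + 1" using GH xyH finH by simp
    finally have "card F3 = card H + 7" by simp
    moreover have "F3 \<subseteq> insert {x, y} (H \<union> K)"
      by (auto simp: F3_def F2_def F1_def GH K_def Q_def)
    ultimately show ?thesis using card_le_rank[of "insert {x, y} (H \<union> K)" F3] J3 finH finK by simp
  qed
  ultimately show False using upper by simp
qed

end

subsection \<open>Sparse graphs\<close>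

definition induced :: "graph \<Rightarrow> nat set \<Rightarrow> graph" where
  "induced G X = {e \<in> G. e \<subseteq> X}"

text \<open>The condition of \<open>rigidity_R\<close> without the ambient \<open>n\<close> and
  without truncated subtraction.\<close>

definition sparse :: "graph \<Rightarrow> bool" where
  "sparse G \<longleftrightarrow> (\<forall>X. finite X \<longrightarrow> 2 \<le> card X \<longrightarrow> card (induced G X) + 3 \<le> 2 * card X)"

lemma finite_induced: "finite G \<Longrightarrow> finite (induced G X)"
  by (simp add: induced_def)

lemma card_induced_mono: "finite G \<Longrightarrow> H \<subseteq> G \<Longrightarrow> card (induced H X) \<le> card (induced G X)"
  by (rule card_mono) (auto simp: induced_def)

lemma sparse_subset:
  assumes "finite G" "sparse G" "H \<subseteq> G"
  shows "sparse H"
  using assms card_induced_mono[OF assms(1,3)] unfolding sparse_def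
  by (meson add_le_mono1 le_trans)

text \<open>Supermodularity: an edge lying in \<open>X\<close> and in \<open>Y\<close> lies in the
  intersection, and an edge lying in either lies in the union.\<close>

lemma card_induced_Un_Int:
  assumes "finite G"
  shows "card (induced G X) + card (induced G Y)
    \<le> card (induced G (X \<union> Y)) + card (induced G (X \<inter> Y))"
proof -
  have "card (induced G X) + card (induced G Y)
      = card (induced G X \<union> induced G Y) + card (induced G X \<inter> induced G Y)"
    by (rule card_Un_Int) (simp_all add: finite_induced assms)
  moreover have "induced G X \<inter> induced G Y = induced G (X \<inter> Y)" by (auto simp: induced_def)
  moreover have "card (induced G X \<union> induced G Y) \<le> card (induced G (X \<union> Y))"
    by (rule card_mono) (auto simp: induced_def assms)
  ultimately show ?thesis by simp
qed

lemma induced_subsingleton: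
  assumes "G \<subseteq> nsets V 2" "finite X" "card X \<le> 1"
  shows "induced G X = {}"
proof -
  have "\<not> e \<subseteq> X" if "e \<in> G" for e
  proof
    assume "e \<subseteq> X"
    then have "card e \<le> 1" using assms(2,3) card_mono le_trans by blast
    moreover have "card e = 2" using assms(1) that by (auto simp: nsets_def)
    ultimately show False by simp
  qed
  then show ?thesis by (auto simp: induced_def)
qed

text \<open>The degrees sum to \<open>2 * card G\<close>, which sparsity keeps below
  \<open>4 * card V\<close>.\<close>

lemma exists_degree_le_3:
  assumes V: "finite V" "2 \<le> card V" and G: "G \<subseteq> nsets V 2" "sparse G"
  shows "\<exists>v\<in>V. card {e \<in> G. v \<in> e} \<le> 3"
proof (rule ccontr)
  assume "\<not> ?thesis"
  then have "(\<Sum>v\<in>V. 4) \<le> (\<Sum>v\<in>V. card {e \<in> G. v \<in> e})"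
    by (intro sum_mono) (auto simp: not_le)
  also have "\<dots> = (\<Sum>e\<in>G. 2)"
  proof (rule sum_multicount_gen)
    show "finite G" using G(1) V(1) finite_imp_finite_nsets finite_subset by blast
    have "{v \<in> V. v \<in> e} = e" "card e = 2" if "e \<in> G" for e
      using that G(1) by (auto simp: nsets_def)
    then show "\<forall>e\<in>G. card {v \<in> V. v \<in> e} = 2" by simp
  qed (rule V(1))
  finally have "4 * card V \<le> 2 * card G" by simp
  moreover have "induced G V = G" using G(1) by (auto simp: induced_def nsets_def)
  then have "card G + 3 \<le> 2 * card V" using G(2) V unfolding sparse_def by metis
  ultimately show False by simp
qed

text \<open>An edge already present makes \<open>{a, b}\<close> tight, as
  \<open>1 = 2 * 2 - 3\<close>. Otherwise a set that becomes too dense through the new edge must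
  contain both its ends and was tight before.\<close>

lemma tight_set_containing:
  assumes G: "sparse G" "finite G" "{a, b} \<in> G \<or> \<not> sparse (insert {a, b} G)" and ab: "a \<noteq> b"
  obtains T where "finite T" "a \<in> T" "b \<in> T" "2 * card T \<le> card (induced G T) + 3"
proof (cases "{a, b} \<in> G")
  case True
  then have "{{a, b}} \<subseteq> induced G {a, b}" by (simp add: induced_def)
  then have "card {{a, b}} \<le> card (induced G {a, b})"
    using finite_induced[OF G(2)] by (rule card_mono[rotated])
  then show thesis using ab by (intro that[of "{a, b}"]) auto
next
  case False
  then obtain X where X: "finite X" "2 \<le> card X"
      "2 * card X < card (induced (insert {a, b} G) X) + 3"
    using G(3) by (auto simp: sparse_def not_le)
  have le: "card (induced G X) + 3 \<le> 2 * card X" using G(1) X by (simp add: sparse_def)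
  have "{a, b} \<subseteq> X"
  proof (rule ccontr)
    assume "\<not> {a, b} \<subseteq> X"
    then have "induced (insert {a, b} G) X = induced G X" by (auto simp: induced_def)
    then show False using X le by simp
  qed
  then have "induced (insert {a, b} G) X = insert {a, b} (induced G X)"
    by (auto simp: induced_def)
  then have "card (induced (insert {a, b} G) X) \<le> card (induced G X) + 1"
    using finite_induced[OF G(2)] by (simp add: card_insert_if)
  then show thesis using X \<open>{a, b} \<subseteq> X\<close> by (intro that[of X]) auto
qed

text \<open>
  The classical Henneberg step. If no edge among the neighbours could be added, three tight sets
  would cover the pairs; their union, or already the union of two of them, would be too dense
  once \<open>v\<close> is added.
\<close>
lemma sparse_reduce_degree_3:
  assumes G: "sparse G" "finite G" "G \<subseteq> nsets V 2"
    and v: "{e \<in> G. v \<in> e} = {{v, x}, {v, y}, {v, z}}"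
    and d: "distinct [v, x, y, z]"
  defines "H \<equiv> {e \<in> G. v \<notin> e}"
  shows "({x, y} \<notin> H \<and> sparse (insert {x, y} H)) \<or> ({y, z} \<notin> H \<and> sparse (insert {y, z} H)) \<or>
    ({x, z} \<notin> H \<and> sparse (insert {x, z} H))"
proof (rule ccontr)
  assume neg: "\<not> ?thesis"
  have H: "sparse H" "finite H" "H \<subseteq> nsets V 2"
    using sparse_subset[OF G(2,1)] G unfolding H_def by auto
  \<comment> \<open>Adding \<open>v\<close> to \<open>X\<close> brings three edges but at most one
    vertex, so \<open>H\<close> must stay one edge below tightness on \<open>X\<close>. The vertex
    \<open>v\<close> may already lie in \<open>X\<close>, which only makes the bound easier.\<close>
  have xyz: "card (induced H X) + 4 \<le> 2 * card X" if X: "finite X" "{x, y, z} \<subseteq> X" for X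
  proof -
    let ?Y = "insert v X" and ?N = "{{v, x}, {v, y}, {v, z}}"
    have "card {x, y, z} \<le> card (X - {v})" using X d by (intro card_mono) auto
    then have c: "3 \<le> card (X - {v})" using d by simp
    have "card (X - {v}) < card ?Y" using X by (intro psubset_card_mono) auto
    then have "card (induced G ?Y) + 3 \<le> 2 * card ?Y"
      using G(1) X c unfolding sparse_def by simp
    moreover have "induced G ?Y = induced H X \<union> ?N"
    proof
      show "induced G ?Y \<subseteq> induced H X \<union> ?N"
        unfolding v[symmetric] induced_def H_def by auto
      have "?N \<subseteq> G" using v by blast
      then show "induced H X \<union> ?N \<subseteq> induced G ?Y"
        using X by (auto simp: induced_def H_def)
    qed
    moreover have "induced H X \<inter> ?N = {}" by (auto simp: induced_def H_def)
    then have "card (induced H X \<union> ?N) = card (induced H X) + card ?N"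
      using finite_induced[OF H(2)] by (intro card_Un_disjoint) auto
    moreover have "card ?N = 3" using d by (simp add: doubleton_eq_iff)
    moreover have "card ?Y \<le> card X + 1" using X by (simp add: card_insert_if)
    ultimately show ?thesis by simp
  qed
  \<comment> \<open>Two tight sets sharing at least two vertices have a tight union, by
    supermodularity; \<open>xyz\<close> forbids this when the union covers \<open>x\<close>,
    \<open>y\<close> and \<open>z\<close>.\<close>
  have pair: "card (S \<inter> T) \<le> 1"
    if "finite S" "finite T" "{x, y, z} \<subseteq> S \<union> T"
      "2 * card S \<le> card (induced H S) + 3" "2 * card T \<le> card (induced H T) + 3" for S T
  proof (rule ccontr)
    assume "\<not> card (S \<inter> T) \<le> 1"
    then have "card (induced H (S \<inter> T)) + 3 \<le> 2 * card (S \<inter> T)"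
      using H(1) that(1) by (simp add: sparse_def)
    moreover have "card (induced H (S \<union> T)) + 4 \<le> 2 * card (S \<union> T)" using xyz that by simp
    moreover have "card S + card T = card (S \<union> T) + card (S \<inter> T)"
      by (rule card_Un_Int) (use that in auto)
    ultimately show False using card_induced_Un_Int[OF H(2), of S T] that by linarith
  qed
  obtain A where A: "finite A" "x \<in> A" "y \<in> A" "2 * card A \<le> card (induced H A) + 3"
    by (rule tight_set_containing[OF H(1,2), of x y]) (use neg d in auto)
  obtain B where B: "finite B" "y \<in> B" "z \<in> B" "2 * card B \<le> card (induced H B) + 3"
    by (rule tight_set_containing[OF H(1,2), of y z]) (use neg d in auto)
  obtain C where C: "finite C" "x \<in> C" "z \<in> C" "2 * card C \<le> card (induced H C) + 3"
    by (rule tight_set_containing[OF H(1,2), of x z]) (use neg d in auto)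
  have "card (A \<inter> B) \<le> 1" "card (A \<inter> C) \<le> 1" "card (B \<inter> C) \<le> 1"
    using pair A B C by auto
  then have "induced H (A \<inter> B) = {}" "induced H (A \<inter> C) = {}" "induced H (B \<inter> C) = {}"
    using induced_subsingleton[OF H(3)] A B C by simp_all
  then have disj: "induced H A \<inter> induced H B = {}" "(induced H A \<union> induced H B) \<inter> induced H C = {}"
    by (auto simp: induced_def)
  \<comment> \<open>The edge sets are disjoint, so the union carries at least
    \<open>2 * (card A + card B + card C) - 9\<close> edges. The vertex count loses at least 1 when
    \<open>B\<close> joins \<open>A\<close> and at least 2 when \<open>C\<close> joins both, so the
    union would be tight, against \<open>xyz\<close>.\<close>
  have "card (induced H A \<union> induced H B \<union> induced H C)
      = card (induced H A) + card (induced H B) + card (induced H C)"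
    using disj by (simp add: card_Un_disjoint finite_induced H(2))
  moreover have "card (induced H A \<union> induced H B \<union> induced H C) \<le> card (induced H (A \<union> B \<union> C))"
    by (rule card_mono) (auto simp: induced_def H(2))
  moreover have "card (induced H (A \<union> B \<union> C)) + 4 \<le> 2 * card (A \<union> B \<union> C)"
    using A B C by (intro xyz) auto
  moreover have "card A + card B = card (A \<union> B) + card (A \<inter> B)"
    by (rule card_Un_Int) (use A B in auto)
  moreover have "card (A \<union> B) + card C = card (A \<union> B \<union> C) + card ((A \<union> B) \<inter> C)"
    by (rule card_Un_Int) (use A B C in auto)
  moreover have "card {y} \<le> card (A \<inter> B)" using A B by (intro card_mono) auto
  moreover have "card {x, z} \<le> card ((A \<union> B) \<inter> C)" using A B C by (intro card_mono) auto
  ultimately show False using A B C d by simp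
qed

section \<open>Henneberg induction: from sparse to independent graphs\<close>

lemma (in rigidity_matroid) sparse_indep:
  assumes K: "complete_bipartite 3 3 \<in> J"
    and "finite V" "G \<subseteq> nsets V 2" "sparse G"
  shows "G \<in> J"
  using assms(2-)
\<comment> \<open>A vertex of degree at most 3 is removed. The cases of few vertices are separate
  because an extension needs at least two vertices to attach to.\<close>
proof (induction "card V" arbitrary: V G rule: less_induct)
  case less
  note V = less.prems(1) and G = less.prems(2,3)
  have finG: "finite G" using V G(1) finite_imp_finite_nsets finite_subset by blast
  consider "card V \<le> 1" | "card V = 2" | "3 \<le> card V" by linarith
  then show ?case
  proof cases
    case 1
    then have "induced G V = {}" by (rule induced_subsingleton[OF G(1) V])
    then have "G = {}" using G(1) by (auto simp: induced_def nsets_def)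
    then show ?thesis using empty_indep by simp
  next
    case 2
    then obtain F where F: "F \<in> J" "F \<subseteq> nsets V 2" "card F = 1"
      using indep_exists[OF V] by auto
    have "card (nsets V 2) = 1" using 2 by (simp add: card_nsets)
    then have "F = nsets V 2"
      using F V by (intro card_subset_eq) (auto simp: finite_imp_finite_nsets)
    then show ?thesis using F(1) G(1) indep_subset by blast
  next
    case 3
    then obtain v where v: "v \<in> V" "card {e \<in> G. v \<in> e} \<le> 3"
      using exists_degree_le_3[OF V _ G] by auto
    define W where "W = V - {v}"
    define H where "H = {e \<in> G. v \<notin> e}"
    have W: "finite W" "v \<notin> W" "card W < card V" "2 \<le> card W"
      using V v 3 by (auto simp: W_def card_Diff1_less card_Diff_singleton)
    have H: "H \<subseteq> nsets W 2" "sparse H"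
      using G sparse_subset[OF finG G(2)] by (auto simp: H_def W_def nsets_def)
    define N where "N = {u \<in> W. {v, u} \<in> G}"
    have edges: "{e \<in> G. v \<in> e} = (\<lambda>u. {v, u}) ` N"
    proof
      show "{e \<in> G. v \<in> e} \<subseteq> (\<lambda>u. {v, u}) ` N"
      proof
        fix e
        assume e: "e \<in> {e \<in> G. v \<in> e}"
        then obtain p q where "e = {p, q}" "p \<in> V" "q \<in> V" "p \<noteq> q"
          using G(1) nsets2_E[of e V] by blast
        then obtain u where u: "e = {v, u}" "u \<in> V" "u \<noteq> v"
          using e by (auto simp: doubleton_eq_iff)
        then show "e \<in> (\<lambda>u. {v, u}) ` N" using e by (auto simp: N_def W_def)
      qed
    qed (auto simp: N_def)
    have NW: "N \<subseteq> W" "finite N" using W by (auto simp: N_def)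
    have "inj_on (\<lambda>u. {v, u}) N" by (auto simp: inj_on_def doubleton_eq_iff)
    then have cN: "card N \<le> 3" using v(2) edges by (simp add: card_image)
    have GH: "G = H \<union> (\<lambda>u. {v, u}) ` N" unfolding edges[symmetric] by (auto simp: H_def)
    show ?thesis
    proof (cases "card N \<le> 2")
      case True
      \<comment> \<open>\<open>v\<close> may have fewer than two neighbours; it is then joined to
        two vertices anyway, and \<open>G\<close> is a subgraph of the result.\<close>
      then obtain P where P: "N \<subseteq> P" "P \<subseteq> W" "card P = 2"
        using exists_subset_between[of N 2 W] W NW by auto
      then obtain a b where ab: "P = {a, b}" "a \<noteq> b" by (auto simp: card_2_iff)
      have "H \<in> J" using less.hyps[OF W(3,1) H] .
      then have "insert {v, a} (insert {v, b} H) \<in> J"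
        using zero_extension[OF _ H(1) W(1) _ _ ab(2) W(2)] P(2) ab by simp
      moreover have "G \<subseteq> insert {v, a} (insert {v, b} H)" using GH P(1) ab(1) by auto
      ultimately show ?thesis by (rule indep_subset)
    next
      case False
      then have "card N = 3" using cN by simp
      then obtain x y z where N: "N = {x, y, z}" and xyz: "distinct [x, y, z]"
        by (auto simp: card_3_iff)
      have inW: "x \<in> W" "y \<in> W" "z \<in> W" using NW N by auto
      \<comment> \<open>The pair \<open>a\<close>, \<open>b\<close> is the one whose edge can be
        added to \<open>H\<close>; the 1-extension subdivides this edge by \<open>v\<close> and
        joins \<open>v\<close> to the third neighbour \<open>c\<close>.\<close>
      have step: "G \<in> J"
        if "{a, b} \<notin> H" "sparse (insert {a, b} H)" "{a, b, c} = {x, y, z}" "distinct [a, b, c]"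
        for a b c
      proof -
        have "{a, b, c} \<subseteq> W" unfolding that(3) using inW by simp
        then have abc: "a \<in> W" "b \<in> W" "c \<in> W" by simp_all
        have sub: "insert {a, b} H \<subseteq> nsets W 2" using H(1) abc that(4) by simp
        have "insert {a, b} H \<in> J" using less.hyps[OF W(3,1) sub that(2)] .
        then have "{{v, a}, {v, b}, {v, c}} \<union> (insert {a, b} H - {{a, b}}) \<in> J"
          by (rule one_extension[OF K _ sub _ W(1) abc that(4) W(2)]) simp
        moreover have "insert {a, b} H - {{a, b}} = H" using that(1) by simp
        moreover have "{{v, a}, {v, b}, {v, c}} = (\<lambda>u. {v, u}) ` N"
          unfolding N that(3)[symmetric] by simp
        ultimately show ?thesis using GH by (simp add: Un_commute)
      qed
      have "({x, y} \<notin> H \<and> sparse (insert {x, y} H)) \<or> ({y, z} \<notin> H \<and> sparse (insert {y, z} H)) \<or>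
          ({x, z} \<notin> H \<and> sparse (insert {x, z} H))"
        unfolding H_def
      proof (rule sparse_reduce_degree_3[OF G(2) finG G(1)])
        show "{e \<in> G. v \<in> e} = {{v, x}, {v, y}, {v, z}}" using edges N by simp
        show "distinct [v, x, y, z]" using xyz inW W(2) by auto
      qed
      then show ?thesis using step[of x y z] step[of y z x] step[of x z y] xyz
        by (auto simp: insert_commute)
    qed
  qed
qed

text \<open>Vertices outside \<open>{1..n}\<close> carry no edges, so \<open>X\<close> may be cut
  down to \<open>{1..n}\<close>. If fewer than two vertices remain there are no edges, and
  \<open>2 \<le> card X\<close> gives the inequality.\<close>

lemma rigidity_R_sparse:
  assumes "G \<in> rigidity_R n"
  shows "sparse G"
  unfolding sparse_def
proof (intro allI impI)
  fix X :: "nat set"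
  assume X: "finite X" "2 \<le> card X"
  have G: "G \<subseteq> nsets {1..n} 2" using assms by (simp add: rigidity_R_def)
  let ?Y = "X \<inter> {1..n}"
  have eq: "induced G X = induced G ?Y" using G by (auto simp: induced_def nsets_def)
  show "card (induced G X) + 3 \<le> 2 * card X"
  proof (cases "2 \<le> card ?Y")
    case True
    moreover have "\<forall>Z\<subseteq>{1..n}. 2 \<le> card Z \<longrightarrow> card (induced G Z) \<le> 2 * card Z - 3"
      using assms by (simp add: rigidity_R_def induced_def)
    ultimately have "card (induced G ?Y) \<le> 2 * card ?Y - 3" by blast
    moreover have "card ?Y \<le> card X" using X(1) by (intro card_mono) auto
    ultimately show ?thesis using eq True by simp
  next
    case False
    then have "induced G ?Y = {}" using X(1) by (intro induced_subsingleton[OF G]) auto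
    then show ?thesis using eq X(2) by simp
  qed
qed

subsection \<open>The matroid of a 2-rigidity family\<close>

text \<open>The merged matroid: all \<open>M n\<close> at once, up to renaming of vertices. It
  instantiates \<open>J\<close>.\<close>

definition family_graphs :: "(nat \<Rightarrow> graph set) \<Rightarrow> graph set" where
  "family_graphs M = {G. G \<subseteq> nsets UNIV 2 \<and> family_indep M G}"

lemma verts_relabel: "verts (relabel f G) = f ` verts G"
  by (auto simp: verts_def relabel_def)

lemma relabel_relabel: "relabel f (relabel g G) = relabel (\<lambda>x. f (g x)) G"
  by (simp add: relabel_def image_image)

lemma relabel_cong:
  assumes "\<And>x. x \<in> verts G \<Longrightarrow> f x = g x"
  shows "relabel f G = relabel g G"
proof -
  have "f ` e = g ` e" if "e \<in> G" for e
    using assms that by (intro image_cong) (auto simp: verts_def)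
  then show ?thesis by (simp add: relabel_def)
qed

lemma relabel_ident: "(\<And>x. x \<in> verts G \<Longrightarrow> f x = x) \<Longrightarrow> relabel f G = G"
  using relabel_cong[of G f "\<lambda>x. x"] by (simp add: relabel_def)

lemma nsets_verts: "G \<subseteq> nsets UNIV 2 \<Longrightarrow> G \<subseteq> nsets (verts G) 2"
  by (auto simp: nsets_def verts_def)

lemma family_graphs_relabel:
  assumes G: "G \<in> family_graphs M" and f: "inj_on f (verts G)"
  shows "relabel f G \<in> family_graphs M"
proof -
  obtain n g where n: "n \<ge> 2" and g: "inj_on g (verts G)" "g ` verts G \<subseteq> {1..n}" "relabel g G \<in> M n"
    using G by (auto simp: family_graphs_def family_indep_def indep_in_def)
  define h where "h = (\<lambda>x. g (the_inv_into (verts G) f x))"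
  have h: "h (f x) = g x" if "x \<in> verts G" for x
    using that f by (simp add: h_def the_inv_into_f_f)
  have "inj_on h (verts (relabel f G))"
    using g(1) h by (auto simp: verts_relabel inj_on_def)
  moreover have "h ` verts (relabel f G) \<subseteq> {1..n}"
    using g(2) h by (auto simp: verts_relabel)
  moreover have "relabel h (relabel f G) = relabel g G"
    unfolding relabel_relabel using h by (rule relabel_cong)
  ultimately have "family_indep M (relabel f G)"
    unfolding family_indep_def indep_in_def using n g(3) by metis
  moreover have "relabel f G \<subseteq> nsets (f ` verts G) 2"
    using G by (intro relabel_subset_nsets f nsets_verts) (simp add: family_graphs_def)
  then have "relabel f G \<subseteq> nsets UNIV 2" by (auto simp: nsets_def)
  ultimately show ?thesis by (simp add: family_graphs_def)
qed

text \<open>The defining compatibility of a matroidal family enters here: a copy independent in some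
  \<open>M m\<close> yields one in \<open>M n\<close>, and symmetry makes the graph itself
  independent there.\<close>

lemma family_graphs_iff:
  assumes M: "matroidal_family M" and n: "n \<ge> 2" and G: "G \<subseteq> nsets {1..n} 2"
  shows "G \<in> family_graphs M \<longleftrightarrow> G \<in> M n"
proof -
  have sym: "symmetric_graph_matroid n (M n)" using M n by (simp add: matroidal_family_def)
  have U: "G \<subseteq> nsets UNIV 2" using G by (auto simp: nsets_def)
  have "verts G \<subseteq> {1..n}" using G by (auto simp: verts_def nsets_def)
  then have "card (verts G) \<le> n" using card_mono[of "{1..n}" "verts G"] by simp
  then have "family_indep M G \<longleftrightarrow> indep_in M n G"
    using M n U unfolding matroidal_family_def family_indep_def by blast
  then show ?thesis using indep_in_iff[of n M G, OF sym G] U by (simp add: family_graphs_def)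
qed

lemma family_graphs_finite:
  assumes "G \<in> family_graphs M"
  shows "finite (verts G)" "finite G"
proof -
  show "finite (verts G)"
    using assms by (auto simp: family_graphs_def family_indep_def indep_in_def)
      (metis finite_atLeastAtMost finite_imageD finite_subset)
  then show "finite G"
    by (rule finite_subset[of _ "Pow (verts G)", rotated, OF iffD2[OF finite_Pow_iff]])
      (auto simp: verts_def)
qed

lemma family_graphs_augment:
  assumes M: "matroidal_family M" and X: "X \<in> family_graphs M" and Y: "Y \<in> family_graphs M"
    and lt: "card X < card Y"
  shows "\<exists>e\<in>Y - X. insert e X \<in> family_graphs M"
proof -
  have fin: "finite (verts X \<union> verts Y)" using X Y by (simp add: family_graphs_finite)
  then obtain N where N: "\<And>i. i \<in> verts X \<union> verts Y \<Longrightarrow> i \<le> N"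
    by (meson finite_nat_set_iff_bounded_le)
  \<comment> \<open>The vertices lie in \<open>{0..N}\<close> but \<open>M n\<close> lives on
    \<open>{1..n}\<close>; after a shift by \<open>Suc\<close> they fit, and \<open>N + 2\<close>
    also ensures \<open>2 \<le> n\<close>.\<close>
  define n where "n = N + 2"
  have n: "n \<ge> 2" by (simp add: n_def)
  have XY: "X \<subseteq> nsets {..N} 2" "Y \<subseteq> nsets {..N} 2"
    using X Y N by (fastforce simp: family_graphs_def nsets_def verts_def)+
  have img: "nsets (Suc ` {..N}) 2 \<subseteq> nsets {1..n} 2"
    by (intro nsets_mono) (auto simp: n_def)
  have sub: "relabel Suc X \<subseteq> nsets {1..n} 2" "relabel Suc Y \<subseteq> nsets {1..n} 2"
    using relabel_subset_nsets[of Suc, OF _ XY(1)] relabel_subset_nsets[of Suc, OF _ XY(2)] img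
    by auto
  have "relabel Suc X \<in> M n" "relabel Suc Y \<in> M n"
    using family_graphs_relabel[OF X] family_graphs_relabel[OF Y]
      family_graphs_iff[OF M n sub(1)] family_graphs_iff[OF M n sub(2)] by auto
  moreover have "card (relabel Suc X) < card (relabel Suc Y)"
    using lt card_relabel[of Suc, OF _ XY(1)] card_relabel[of Suc, OF _ XY(2)] by simp
  moreover have "matroid (nsets {1..n} 2) (M n)"
    using M n by (simp add: matroidal_family_def symmetric_graph_matroid_def)
  ultimately obtain d where d: "d \<in> relabel Suc Y - relabel Suc X" "insert d (relabel Suc X) \<in> M n"
    unfolding matroid_def by blast
  then obtain e where e: "e \<in> Y - X" "d = Suc ` e" by (auto simp: relabel_def)
  have eq: "insert d (relabel Suc X) = relabel Suc (insert e X)" using e by (simp add: relabel_def)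
  have "relabel Suc (insert e X) \<subseteq> nsets {1..n} 2" using sub d(1) eq by auto
  then have "relabel Suc (insert e X) \<in> family_graphs M"
    using family_graphs_iff[OF M n] d(2) eq by simp
  \<comment> \<open>Undoing the shift is injective, since all vertices present are
    successors.\<close>
  then have "relabel (\<lambda>i. i - 1) (relabel Suc (insert e X)) \<in> family_graphs M"
    by (rule family_graphs_relabel) (auto simp: verts_relabel inj_on_def)
  then have "insert e X \<in> family_graphs M" by (simp add: relabel_relabel relabel_ident)
  then show ?thesis using e by blast
qed

lemma matroid_rank_bounds:
  assumes "matroid E I"
  shows "X \<in> I \<Longrightarrow> card X \<le> matroid_rank I" "\<exists>X\<in>I. card X = matroid_rank I"
proof -
  have fin: "finite I" and ne: "I \<noteq> {}"
    using assms finite_subset[of I "Pow E"] by (auto simp: matroid_def)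
  show "X \<in> I \<Longrightarrow> card X \<le> matroid_rank I" using fin by (simp add: matroid_rank_def)
  have "matroid_rank I \<in> card ` I" unfolding matroid_rank_def using fin ne by (intro Max_in) auto
  then show "\<exists>X\<in>I. card X = matroid_rank I" by auto
qed

lemma family_graphs_rigidity_matroid:
  assumes "two_rigidity_family M"
  shows "rigidity_matroid (family_graphs M)"
proof
  have M: "matroidal_family M" and rk: "\<And>n. n \<ge> 2 \<Longrightarrow> matroid_rank (M n) = 2 * n - 3"
    using assms by (auto simp: two_rigidity_family_def)
  have mat: "matroid (nsets {1..n} 2) (M n)" if "n \<ge> 2" for n
    using M that by (simp add: matroidal_family_def symmetric_graph_matroid_def)
  show "{} \<in> family_graphs M"
    using family_graphs_iff[OF M, of 2 "{}"] mat[of 2] by (simp add: matroid_def)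
  show "finite X" if "X \<in> family_graphs M" for X
    using that by (rule family_graphs_finite)
  show "relabel f G \<in> family_graphs M" if "G \<in> family_graphs M" "inj_on f (verts G)" for G f
    using that by (rule family_graphs_relabel)
  show "\<exists>e\<in>Y - X. insert e X \<in> family_graphs M"
    if "X \<in> family_graphs M" "Y \<in> family_graphs M" "card X < card Y" for X Y
    using M that by (rule family_graphs_augment)
  show "Y \<in> family_graphs M" if X: "X \<in> family_graphs M" and Y: "Y \<subseteq> X" for X Y
  proof -
    obtain n g where n: "n \<ge> 2" and g: "inj_on g (verts X)" "g ` verts X \<subseteq> {1..n}" "relabel g X \<in> M n"
      using X by (auto simp: family_graphs_def family_indep_def indep_in_def)
    have v: "verts Y \<subseteq> verts X" and "relabel g Y \<subseteq> relabel g X"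
      using Y by (auto simp: verts_def relabel_def)
    then have "relabel g Y \<in> M n" using mat[OF n] g(3) unfolding matroid_def by blast
    moreover have "inj_on g (verts Y)" "g ` verts Y \<subseteq> {1..n}"
      using g v inj_on_subset by blast+
    ultimately show ?thesis
      using n X Y unfolding family_graphs_def family_indep_def indep_in_def by blast
  qed
  fix V :: "nat set"
  assume V: "finite V" "2 \<le> card V"
  \<comment> \<open>Numbering the vertices of \<open>V\<close> by \<open>{1..card V}\<close> moves
    both remaining claims into \<open>M (card V)\<close>, whose rank is given.\<close>
  obtain f where f: "bij_betw f V {1..card V}"
    using finite_same_card_bij[OF V(1), of "{1..card V}"] by auto
  then have inj: "inj_on f V" and im: "f ` V = {1..card V}" by (auto simp: bij_betw_def)
  show "card G \<le> 2 * card V - 3" if G: "G \<in> family_graphs M" "G \<subseteq> nsets V 2" for G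
  proof -
    have "verts G \<subseteq> V" using G(2) by (auto simp: verts_def nsets_def)
    then have "relabel f G \<in> family_graphs M"
      using family_graphs_relabel[OF G(1)] inj inj_on_subset by blast
    then have "relabel f G \<in> M (card V)"
      using family_graphs_iff[OF M V(2)] relabel_subset_nsets[OF inj G(2)] im by simp
    then show ?thesis
      using matroid_rank_bounds(1)[OF mat[OF V(2)]] rk[OF V(2)] card_relabel[OF inj G(2)] by fastforce
  qed
  obtain G where G: "G \<in> M (card V)" "card G = 2 * card V - 3"
    using matroid_rank_bounds(2)[OF mat[OF V(2)]] rk[OF V(2)] by auto
  have sub: "G \<subseteq> nsets {1..card V} 2" using mat[OF V(2)] G(1) by (auto simp: matroid_def)
  have GF: "G \<in> family_graphs M" using family_graphs_iff[OF M V(2) sub] G(1) by simp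
  define h where "h = the_inv_into V f"
  have h: "inj_on h {1..card V}" "h ` {1..card V} = V"
    using bij_betw_the_inv_into[OF f] by (auto simp: h_def bij_betw_def)
  have "verts G \<subseteq> {1..card V}" using sub by (auto simp: verts_def nsets_def)
  then have "relabel h G \<in> family_graphs M"
    using family_graphs_relabel[OF GF] h(1) inj_on_subset by blast
  moreover have "relabel h G \<subseteq> nsets V 2" using relabel_subset_nsets[OF h(1) sub] h(2) by simp
  moreover have "card (relabel h G) = 2 * card V - 3" using card_relabel[OF h(1) sub] G(2) by simp
  ultimately show "\<exists>G\<in>family_graphs M. G \<subseteq> nsets V 2 \<and> card G = 2 * card V - 3" by blast
qed

theorem theorem1p6:
  fixes M :: "nat \<Rightarrow> nat set set set"
  assumes "two_rigidity_family M"
    and "\<exists>n\<ge>2. M n \<noteq> rigidity_R n"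
  shows "family_circuit M (complete_bipartite 3 3)"
proof -
  interpret rigidity_matroid "family_graphs M"
    using assms(1) by (rule family_graphs_rigidity_matroid)
  have M: "matroidal_family M" using assms(1) by (simp add: two_rigidity_family_def)
  have sub: "complete_bipartite 3 3 \<subseteq> nsets UNIV 2" by (auto simp: complete_bipartite_def)
  have "complete_bipartite 3 3 \<notin> family_graphs M"
  proof
    assume K: "complete_bipartite 3 3 \<in> family_graphs M"
    have "M n = rigidity_R n" if n: "n \<ge> 2" for n
    proof
      show "M n \<subseteq> rigidity_R n"
      proof
        fix G
        assume G: "G \<in> M n"
        have "matroid (nsets {1..n} 2) (M n)"
          using M n by (simp add: matroidal_family_def symmetric_graph_matroid_def)
        then have G2: "G \<subseteq> nsets {1..n} 2" using G unfolding matroid_def by blast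
        then have GF: "G \<in> family_graphs M" using family_graphs_iff[OF M n] G by simp
        \<comment> \<open>The part of \<open>G\<close> inside \<open>X\<close> is independent on
          \<open>card X\<close> vertices, so the rank formula bounds it.\<close>
        have "card {e \<in> G. e \<subseteq> X} \<le> 2 * card X - 3" if "X \<subseteq> {1..n}" "2 \<le> card X" for X
        proof (rule indep_card_le)
          show "{e \<in> G. e \<subseteq> X} \<in> family_graphs M" using GF by (rule indep_subset) auto
          show "{e \<in> G. e \<subseteq> X} \<subseteq> nsets X 2" using G2 by (auto simp: nsets_def)
        qed (use that finite_subset in auto)
        then show "G \<in> rigidity_R n" using G2 by (simp add: rigidity_R_def)
      qed
      show "rigidity_R n \<subseteq> M n"
      proof
        fix G
        assume G: "G \<in> rigidity_R n"
        then have G2: "G \<subseteq> nsets {1..n} 2" by (simp add: rigidity_R_def)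
        have "G \<in> family_graphs M"
          using sparse_indep[OF K _ G2 rigidity_R_sparse[OF G]] by simp
        then show "G \<in> M n" using family_graphs_iff[OF M n G2] by simp
      qed
    qed
    then show False using assms(2) by blast
  qed
  moreover have "H \<in> family_graphs M" if H: "H \<subset> complete_bipartite 3 3" for H
  proof -
    \<comment> \<open>A proper subgraph misses some edge \<open>e\<close>, so the full graph without
      \<open>e\<close> contains it; naming the sides so that \<open>e\<close> is
      \<open>{u, w}\<close> matches \<open>K33_minus_edge_indep\<close>.\<close>
    obtain e where e: "e \<in> complete_bipartite 3 3" "e \<notin> H" using H by blast
    then obtain u w :: nat where uw: "e = {u, w}" "u \<in> {1..3}" "w \<in> {4..6}"
      by (auto simp: complete_bipartite_def)
    have "card ({1..3} - {u}) = 2" "card ({4..6} - {w}) = 2" using uw by simp_all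
    then obtain a b c d where ab: "{1..3} - {u} = {a, b}" "a \<noteq> b"
        and cd: "{4..6} - {w} = {c, d}" "c \<noteq> d"
      by (auto simp: card_2_iff)
    have abu: "{1..3} = {a, b, u}" and au: "a \<noteq> u" "b \<noteq> u" using ab(1) uw(2) by blast+
    have cdw: "{4..6} = {c, d, w}" and cw: "c \<noteq> w" "d \<noteq> w" using cd(1) uw(3) by blast+
    have "{1..3} \<inter> {4..6::nat} = {}" by simp
    then have "{a, b, u} \<inter> {c, d, w} = {}" unfolding abu cdw .
    then have "distinct [a, b, u, c, d, w]" using ab(2) cd(2) au cw by auto
    then have "{{a, c}, {b, c}, {a, d}, {b, d}, {u, c}, {u, d}, {w, a}, {w, b}} \<in> family_graphs M"
      by (rule K33_minus_edge_indep)
    moreover have "H \<subseteq> {{a, c}, {b, c}, {a, d}, {b, d}, {u, c}, {u, d}, {w, a}, {w, b}}"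
    proof
      fix h
      assume h: "h \<in> H"
      then have "h \<in> complete_bipartite 3 3" using H by blast
      then obtain p q :: nat where pq: "h = {p, q}" "p \<in> {1..3}" "q \<in> {4..6}"
        by (auto simp: complete_bipartite_def)
      have "p \<in> {a, b, u}" "q \<in> {c, d, w}" using pq abu cdw by blast+
      moreover have "{p, q} \<noteq> {u, w}" using h e(2) pq(1) uw(1) by auto
      ultimately show "h \<in> {{a, c}, {b, c}, {a, d}, {b, d}, {u, c}, {u, d}, {w, a}, {w, b}}"
        unfolding pq(1) by (elim insertE emptyE) (simp_all add: insert_commute)
    qed
    ultimately show ?thesis by (rule indep_subset)
  qed
  ultimately show ?thesis using sub by (auto simp: family_circuit_def family_graphs_def)
qed

end
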